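(* Let $T$ be a tree with $n$ vertices and maximum degree at most $\Delta$ (where $\Delta=\Delta(n)$ may depend on $n$). Then the binomial random graph $G=\mathcal{G}(n,p)$ with $p=\Delta\log^5 n/n$ almost surely contains a copy of $T$. Precisely: for any sequence of trees $T_n$, where $T_n$ has $n$ vertices and maximum degree at most $\Delta(n)$, $\mathbb{P}\big(\mathcal{G}(n,\Delta(n)\log^5 n/n)\text{ contains a copy of } T_n\big)\to 1$ as $n\to\infty$.
   Context: $\mathcal{G}(n,p)$ is the random graph on $n$ vertices in which each pair of vertices is an edge independently with probability $p$ (if $p\ge 1$ it is the complete graph). $\log$ denotes the natural logarithm. *)

theory Defs
  imports "HOL-Probability.Probability"
begin

record 'a sgraph =
  verts :: "'a set"
  edges :: "'a set set"

definition pairs :: "'a set \<Rightarrow> 'a set set" where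
  "pairs V = {e. e \<subseteq> V \<and> card e = 2}"

definition simple_graph :: "'a sgraph \<Rightarrow> bool" where
  "simple_graph G \<longleftrightarrow> finite (verts G) \<and> edges G \<subseteq> pairs (verts G)"

definition vertex_degree :: "'a sgraph \<Rightarrow> 'a \<Rightarrow> nat" where
  "vertex_degree G v = card {e \<in> edges G. v \<in> e}"

text \<open>Only meaningful for finite graphs with at least one vertex.\<close>

definition max_degree :: "'a sgraph \<Rightarrow> nat" where
  "max_degree G = Max (vertex_degree G ` verts G)"

definition adjacent :: "'a sgraph \<Rightarrow> 'a \<Rightarrow> 'a \<Rightarrow> bool" where
  "adjacent G u v \<longleftrightarrow> {u, v} \<in> edges G"

definition connected_graph :: "'a sgraph \<Rightarrow> bool" where
  "connected_graph G \<longleftrightarrow>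
     verts G \<noteq> {} \<and> (\<forall>u\<in>verts G. \<forall>v\<in>verts G. (adjacent G)\<^sup>*\<^sup>* u v)"

text \<open>A cycle is given by the list of its (at least three) distinct vertices in cyclic order.\<close>

definition is_cycle :: "'a sgraph \<Rightarrow> 'a list \<Rightarrow> bool" where
  "is_cycle G c \<longleftrightarrow> length c \<ge> 3 \<and> distinct c \<and>
     (\<forall>i<length c. adjacent G (c ! i) (c ! (Suc i mod length c)))"

definition is_tree :: "'a sgraph \<Rightarrow> bool" where
  "is_tree G \<longleftrightarrow> simple_graph G \<and> connected_graph G \<and> \<not> (\<exists>c. is_cycle G c)"

text \<open>A copy of \<open>H\<close> is a subgraph isomorphic to \<open>H\<close>, not necessarily an induced one.\<close>

definition contains_copy :: "'a sgraph \<Rightarrow> 'b sgraph \<Rightarrow> bool" where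
  "contains_copy G H \<longleftrightarrow>
     (\<exists>f. inj_on f (verts H) \<and> f ` verts H \<subseteq> verts G \<and> (\<forall>e\<in>edges H. f ` e \<in> edges G))"

text \<open>
  The edge probability is truncated at 1, so for \<open>p \<ge> 1\<close> this is the complete graph
  on \<open>{..<n}\<close>, almost surely.
\<close>

definition gnp :: "nat \<Rightarrow> real \<Rightarrow> nat sgraph pmf" where
  "gnp n p =
     map_pmf (\<lambda>X. \<lparr>verts = {..<n}, edges = {e \<in> pairs {..<n}. X e}\<rparr>)
       (Pi_pmf (pairs {..<n}) False (\<lambda>_. bernoulli_pmf (min 1 p)))"

lemma finite_pairs: "finite V \<Longrightarrow> finite (pairs V)"
  unfolding pairs_def by simp

lemma gnp_complete:
  assumes "p \<ge> 1"
  shows "gnp n p = return_pmf \<lparr>verts = {..<n}, edges = pairs {..<n}\<rparr>"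
proof -
  have "bernoulli_pmf 1 = return_pmf True"
  proof (rule pmf_eqI)
    fix b show "pmf (bernoulli_pmf 1) b = pmf (return_pmf True) b"
      by (cases b) simp_all
  qed
  moreover have "min 1 p = 1" using assms by simp
  ultimately show ?thesis
    unfolding gnp_def by (simp add: finite_pairs)
qed

end

theory Submission
  imports Defs "HOL-Real_Asymp.Real_Asymp"
begin

text \<open>
  A uniformly random copy of a tree with maximum degree \<open>\<Delta>\<close> is spread: it contains a given edge set
  \<open>S\<close> with probability at most \<open>(2 e\<^sup>2 \<Delta> / n) ^ card S\<close>. For a spread family \<open>R\<close>, the argument of
  Alweiss, Lovasz, Wu and Zhang, in the form given to it by Frankston, Kahn, Narayanan and Park, shows
  that a random set contains a member. The random set is exposed in about \<open>ln\<^sup>2 n\<close> independent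
  rounds. In each round, for all but a small fraction of the indices, the part of \<open>R i\<close> that is still
  missing may be replaced by a subset of itself that is smaller by a factor \<open>1 - 1 / ln n\<close> and completes
  some member. The failure probability of a round is of order \<open>1 / ln\<^sup>3 n\<close> when the edge probability
  per round is of order \<open>\<Delta> ln\<^sup>3 n / n\<close>.
\<close>

subsection \<open>Binomial random subsets\<close>

text \<open>The default \<open>False\<close> confines the sampled set to \<open>X\<close>. Sets,
  rather than predicates, let independent rounds be combined by union.\<close>

definition random_subset :: "'e set \<Rightarrow> real \<Rightarrow> 'e set pmf" where
  "random_subset X p = map_pmf Collect (Pi_pmf X False (\<lambda>_. bernoulli_pmf p))"

lemma pmf_random_subset:
  assumes "finite X" "W \<subseteq> X" "0 \<le> p" "p \<le> 1"
  shows "pmf (random_subset X p) W = p ^ card W * (1 - p) ^ card (X - W)"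
proof -
  have "pmf (random_subset X p) W = pmf (Pi_pmf X False (\<lambda>_. bernoulli_pmf p)) (\<lambda>e. e \<in> W)"
    unfolding random_subset_def
    using pmf_map_inj'[of Collect "Pi_pmf X False (\<lambda>_. bernoulli_pmf p)" "\<lambda>e. e \<in> W"]
    by (simp add: injI Collect_inj)
  also have "\<dots> = (\<Prod>e\<in>X. pmf (bernoulli_pmf p) (e \<in> W))"
    using assms by (subst pmf_Pi') auto
  also have "\<dots> = (\<Prod>e\<in>W. pmf (bernoulli_pmf p) (e \<in> W)) * (\<Prod>e\<in>X - W. pmf (bernoulli_pmf p) (e \<in> W))"
    using assms by (metis mult.commute prod.subset_diff)
  also have "(\<Prod>e\<in>W. pmf (bernoulli_pmf p) (e \<in> W)) = p ^ card W"
    using assms by simp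
  also have "(\<Prod>e\<in>X - W. pmf (bernoulli_pmf p) (e \<in> W)) = (1 - p) ^ card (X - W)"
    using assms by simp
  finally show ?thesis .
qed

lemma set_random_subset:
  assumes "finite X"
  shows "set_pmf (random_subset X p) \<subseteq> Pow X"
  using set_Pi_pmf_subset[OF assms, of False "\<lambda>_. bernoulli_pmf p"]
  unfolding random_subset_def by auto

text \<open>An element is missed by two independent rounds with probability
  \<open>(1 - p) * (1 - p')\<close>, so the union is again binomial. This allows the random set to
  be exposed in rounds.\<close>

lemma random_subset_union:
  fixes p p' :: real
  assumes "finite X" "0 \<le> p" "p \<le> 1" "0 \<le> p'" "p' \<le> 1"
  shows "random_subset X (p + p' - p * p') =
         random_subset X p \<bind> (\<lambda>A. map_pmf ((\<union>) A) (random_subset X p'))"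
proof -
  have b: "bernoulli_pmf (p + p' - p * p') =
      bernoulli_pmf p \<bind> (\<lambda>a. bernoulli_pmf p' \<bind> (\<lambda>b. return_pmf (a \<or> b)))"
  proof (rule pmf_eqI)
    fix c :: bool
    have "0 \<le> (1 - p) * (1 - p')" "0 \<le> p + p' * (1 - p)" using assms by auto
    hence "0 \<le> p + p' - p * p'" "p + p' - p * p' \<le> 1" by (auto simp: algebra_simps)
    thus "pmf (bernoulli_pmf (p + p' - p * p')) c = pmf (bernoulli_pmf p \<bind>
        (\<lambda>a. bernoulli_pmf p' \<bind> (\<lambda>b. return_pmf (a \<or> b)))) c"
      using assms by (cases c) (auto simp: pmf_bind integral_bernoulli_pmf algebra_simps)
  qed
  let ?P = "\<lambda>p. Pi_pmf X False (\<lambda>_. bernoulli_pmf p)"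
  have "?P (p + p' - p * p') =
      ?P p \<bind> (\<lambda>f. ?P p' \<bind> (\<lambda>g. return_pmf (\<lambda>x. if x \<in> X then f x \<or> g x else False)))"
    unfolding b using assms(1) by (simp add: Pi_pmf_bind[where d' = False])
  hence "random_subset X (p + p' - p * p') =
      ?P p \<bind> (\<lambda>f. ?P p' \<bind> (\<lambda>g. return_pmf {x \<in> X. f x \<or> g x}))"
    unfolding random_subset_def map_pmf_def by (simp add: bind_assoc_pmf bind_return_pmf conj_commute)
      (auto intro!: bind_pmf_cong simp: set_eq_iff)
  also have "\<dots> = ?P p \<bind> (\<lambda>f. ?P p' \<bind> (\<lambda>g. return_pmf (Collect f \<union> Collect g)))"
    using set_Pi_pmf_subset[OF assms(1), of False]
    by (intro bind_pmf_cong refl arg_cong[of _ _ return_pmf]) blast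
  also have "\<dots> = random_subset X p \<bind> (\<lambda>A. map_pmf ((\<union>) A) (random_subset X p'))"
    unfolding random_subset_def map_pmf_def by (simp add: bind_assoc_pmf bind_return_pmf)
  finally show ?thesis .
qed

text \<open>Two-round exposure as an average over the first outcome; as \<open>X\<close> is finite,
  a finite sum suffices.\<close>

lemma prob_random_subset_union:
  assumes "finite X" "0 \<le> p" "p \<le> 1" "0 \<le> p'" "p' \<le> 1"
  shows "measure_pmf.prob (random_subset X (p + p' - p * p')) U =
    (\<Sum>A\<in>Pow X. pmf (random_subset X p) A * measure_pmf.prob (random_subset X p') {B. A \<union> B \<in> U})"
proof -
  have "ennreal (measure_pmf.prob (random_subset X (p + p' - p * p')) U) =
     emeasure (random_subset X (p + p' - p * p')) U"
    by (simp add: measure_pmf.emeasure_eq_measure)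
  also have "\<dots> = (\<integral>\<^sup>+A. emeasure (random_subset X p') {B. A \<union> B \<in> U} \<partial>random_subset X p)"
    unfolding random_subset_union[OF assms] by (simp add: vimage_def)
  also have "\<dots> = (\<Sum>A\<in>Pow X. emeasure (random_subset X p') {B. A \<union> B \<in> U} * pmf (random_subset X p) A)"
    using set_random_subset[OF assms(1), of p] assms(1)
    by (intro nn_integral_measure_pmf_support) auto
  also have "\<dots> = ennreal (\<Sum>A\<in>Pow X. pmf (random_subset X p) A *
       measure_pmf.prob (random_subset X p') {B. A \<union> B \<in> U})"
    by (simp add: measure_pmf.emeasure_eq_measure sum_ennreal[symmetric] ennreal_mult mult.commute)
  finally show ?thesis
    by (subst (asm) ennreal_inj) (auto intro!: sum_nonneg)
qed

lemma sum_pmf_random_subset: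
  assumes "finite X"
  shows "(\<Sum>A\<in>Pow X. pmf (random_subset X p) A) = 1"
  using assms set_random_subset[OF assms, of p] by (intro sum_pmf_eq_1) auto

text \<open>Coupling: a further independent round of density \<open>r\<close> with
  \<open>(1 - r) * (1 - p) = 1 - p'\<close> enlarges a set of density \<open>p\<close> to one of
  density \<open>p'\<close>, and an upward closed \<open>U\<close> survives enlargement.\<close>

lemma prob_random_subset_mono:
  assumes "finite X" "0 \<le> p" "p \<le> p'" "p' \<le> 1"
    and up: "\<And>A B. A \<in> U \<Longrightarrow> A \<subseteq> B \<Longrightarrow> B \<in> U"
  shows "measure_pmf.prob (random_subset X p) U \<le> measure_pmf.prob (random_subset X p') U"
proof (cases "p = 1")
  case True
  thus ?thesis using assms by simp
next
  case False
  define r where "r = (p' - p) / (1 - p)"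
  have r: "0 \<le> r" "r \<le> 1" using assms False by (auto simp: r_def divide_simps)
  have "r + p - r * p = p'" using False assms by (auto simp: r_def divide_simps) (auto simp: algebra_simps)
  hence "measure_pmf.prob (random_subset X p') U = (\<Sum>A\<in>Pow X. pmf (random_subset X r) A *
       measure_pmf.prob (random_subset X p) {B. A \<union> B \<in> U})"
    using prob_random_subset_union[OF assms(1) r, of p U] assms by simp
  also have "\<dots> \<ge> (\<Sum>A\<in>Pow X. pmf (random_subset X r) A * measure_pmf.prob (random_subset X p) U)"
    using up by (intro sum_mono mult_left_mono measure_pmf.finite_measure_mono) auto
  finally show ?thesis
    using sum_pmf_random_subset[OF assms(1), of r] by (simp add: sum_distrib_right[symmetric])
qed

lemma gnp_eq_random_subset:
  "gnp n p = map_pmf (\<lambda>W. \<lparr>verts = {..<n}, edges = W\<rparr>) (random_subset (pairs {..<n}) (min 1 p))"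
  unfolding gnp_def random_subset_def pmf.map_comp
  using set_Pi_pmf_subset[OF finite_pairs, of "{..<n}" False "\<lambda>_. bernoulli_pmf (min 1 p)"]
  by (intro pmf.map_cong refl) (auto simp: finite_pairs)

subsection \<open>Spread families\<close>

text \<open>
  The counting step. If the pair \<open>(W, i)\<close> is bad, let \<open>Z = W \<union> R i\<close> and let \<open>R (c Z)\<close> be a member
  contained in \<open>Z\<close> chosen from \<open>Z\<close> alone. Then \<open>R (c Z) - W \<subseteq> R i\<close> has more than \<open>w'\<close> elements, so
  \<open>A = R (c Z) \<inter> R i\<close> has as well. The pair is encoded by \<open>Z\<close>, by \<open>A\<close> (at most \<open>2 ^ w\<close> choices),
  by \<open>i\<close> (few choices, as \<open>A \<subseteq> R i\<close>), and by \<open>R i - W\<close> (again \<open>2 ^ w\<close> choices).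
\<close>

lemma expected_card_bad_le:
  fixes R :: "'i \<Rightarrow> 'e set" and p q M :: real
  assumes X: "finite X" and I: "finite I" and p: "0 < p" "p \<le> 1" and q: "0 < q" "q \<le> 1" and M: "0 \<le> M"
    and RX: "\<And>i. i \<in> I \<Longrightarrow> R i \<subseteq> X" and Rw: "\<And>i. i \<in> I \<Longrightarrow> card (R i) \<le> w"
    and spread: "\<And>S. real (card {i \<in> I. S \<subseteq> R i}) \<le> q ^ card S * M"
  shows "(\<Sum>W\<in>Pow X. pmf (random_subset X p) W *
            real (card {i \<in> I. \<not> (\<exists>j\<in>I. R j - W \<subseteq> R i \<and> card (R j - W) \<le> w')}))
         \<le> (4 / p) ^ w * q ^ Suc w' * M"
proof -
  let ?m = "pmf (random_subset X p)"
  define bad where "bad W = {i \<in> I. \<not> (\<exists>j\<in>I. R j - W \<subseteq> R i \<and> card (R j - W) \<le> w')}" for W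
  define ZZ where "ZZ = {Z \<in> Pow X. \<exists>j\<in>I. R j \<subseteq> Z}"
  define c where "c Z = (SOME j. j \<in> I \<and> R j \<subseteq> Z)" for Z
  define AA where "AA Z = {A. A \<subseteq> R (c Z) \<and> w' < card A}" for Z
  define II where "II A = {i \<in> I. A \<subseteq> R i}" for A
  define Q where "Q = Sigma ZZ (\<lambda>Z. Sigma (AA Z) (\<lambda>A. Sigma (II A) (\<lambda>i. Pow (R i))))"
  \<comment> \<open>The weight of a code: the mass of \<open>W\<close> is traded for that of
    \<open>Z\<close>, at a loss of at most \<open>1 / p\<close> for each of the at most
    \<open>w\<close> added elements.\<close>
  define f where "f = (\<lambda>(Z, A :: 'e set, i :: 'i, B :: 'e set). ?m Z * (1 / p) ^ w)"
  define h where "h = (\<lambda>(W, i). (W \<union> R i, R (c (W \<union> R i)) \<inter> R i, i, R i - W))"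
  have c: "c Z \<in> I \<and> R (c Z) \<subseteq> Z" if "\<exists>j\<in>I. R j \<subseteq> Z" for Z
    unfolding c_def by (rule someI_ex) (use that in blast)
  have finR: "finite (R i)" if "i \<in> I" for i
    using RX[OF that] X finite_subset by blast
  have fin: "finite ZZ" "\<And>Z. Z \<in> ZZ \<Longrightarrow> finite (AA Z)" "\<And>A. finite (II A)"
      "\<And>A i. i \<in> II A \<Longrightarrow> finite (Pow (R i))"
    using X I c finR by (auto simp: ZZ_def AA_def II_def)
  have finQ: "finite Q"
    unfolding Q_def using fin by (intro finite_SigmaI) auto
  have weight: "?m W \<le> ?m (W \<union> R i) * (1 / p) ^ w" if "W \<subseteq> X" "i \<in> I" for W i
  proof -
    have fW: "finite W" using that X finite_subset by blast
    have cZ: "card (W \<union> R i) = card W + card (R i - W)"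
      using card_Un_disjoint[of W "R i - W"] fW finR[OF that(2)] by auto
    have cY: "card (X - W) = card (X - (W \<union> R i)) + card (R i - W)"
    proof -
      have "X - W = (X - (W \<union> R i)) \<union> (R i - W)" using RX[OF that(2)] by auto
      thus ?thesis using X finR[OF that(2)] by (subst card_Un_disjoint[symmetric]) auto
    qed
    have "card (R i - W) \<le> w"
      using Rw[OF that(2)] card_mono[OF finR[OF that(2)], of "R i - W"] by simp
    hence "p ^ w \<le> p ^ card (R i - W)"
      using p by (intro power_decreasing) auto
    hence "1 \<le> p ^ card (R i - W) * (1 / p) ^ w"
      using p by (simp add: power_divide divide_simps)
    moreover have "(1 - p) ^ card (R i - W) \<le> 1"
      using p by (intro power_le_one) auto
    ultimately have le: "(1 - p) ^ card (R i - W) \<le> p ^ card (R i - W) * (1 / p) ^ w"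
      by linarith
    have "?m W = p ^ card W * (1 - p) ^ card (X - (W \<union> R i)) * (1 - p) ^ card (R i - W)"
      using pmf_random_subset[OF X that(1), of p] p by (simp add: cY power_add mult_ac)
    also have "\<dots> \<le> p ^ card W * (1 - p) ^ card (X - (W \<union> R i)) * (p ^ card (R i - W) * (1 / p) ^ w)"
      using p le by (intro mult_left_mono) auto
    also have "\<dots> = ?m (W \<union> R i) * (1 / p) ^ w"
      using pmf_random_subset[OF X, of "W \<union> R i" p] p RX[OF that(2)] that(1)
      by (simp add: cZ power_add mult_ac)
    finally show ?thesis .
  qed
  have h: "h ` Sigma (Pow X) bad \<subseteq> Q"
  proof (rule image_subsetI)
    fix x assume "x \<in> Sigma (Pow X) bad"
    then obtain W i where x: "x = (W, i)" and W: "W \<subseteq> X" and i: "i \<in> bad W" by auto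
    hence iI: "i \<in> I" by (simp add: bad_def)
    let ?Z = "W \<union> R i"
    have ex: "\<exists>j\<in>I. R j \<subseteq> ?Z" using iI by auto
    note cZ = c[OF this]
    hence sub: "R (c ?Z) - W \<subseteq> R (c ?Z) \<inter> R i" by auto
    with i cZ have "w' < card (R (c ?Z) - W)" by (auto simp: bad_def)
    also have "\<dots> \<le> card (R (c ?Z) \<inter> R i)"
      using sub finR[OF iI] by (intro card_mono) auto
    finally show "h x \<in> Q"
      using x W iI RX[OF iI] ex by (auto simp: h_def Q_def ZZ_def AA_def II_def)
  qed
  have inj: "inj_on h (Sigma (Pow X) bad)"
  proof (rule inj_on_inverseI)
    \<comment> \<open>\<open>Z - (R i - W)\<close> gives back \<open>W\<close>, so the code
      determines the pair.\<close>
    fix x assume "x \<in> Sigma (Pow X) bad"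
    thus "(\<lambda>(Z, A, i, B). (Z - B, i)) (h x) = x" by (auto simp: h_def)
  qed
  have finb: "finite (bad W)" for W using I by (simp add: bad_def)
  have "(\<Sum>W\<in>Pow X. ?m W * real (card (bad W))) = (\<Sum>W\<in>Pow X. \<Sum>i\<in>bad W. ?m W)"
    by (simp add: mult.commute)
  also have "\<dots> = (\<Sum>(W, i)\<in>Sigma (Pow X) bad. ?m W)"
    using X finb by (intro sum.Sigma) auto
  also have "\<dots> \<le> (\<Sum>x\<in>Sigma (Pow X) bad. f (h x))"
    using weight by (intro sum_mono) (auto simp: f_def h_def bad_def)
  also have "\<dots> = sum f (h ` Sigma (Pow X) bad)"
    using inj by (simp add: sum.reindex)
  also have "\<dots> \<le> sum f Q"
    using h finQ p by (intro sum_mono2) (auto simp: f_def split: prod.splits)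
  also have "\<dots> = (\<Sum>Z\<in>ZZ. \<Sum>A\<in>AA Z. \<Sum>i\<in>II A. \<Sum>B\<in>Pow (R i). ?m Z * (1 / p) ^ w)"
    unfolding Q_def f_def using fin
    by (simp add: sum.Sigma[symmetric] finite_SigmaI sum_distrib_right)
  also have "\<dots> \<le> (\<Sum>Z\<in>ZZ. ?m Z * ((4 / p) ^ w * q ^ Suc w' * M))"
  proof (rule sum_mono)
    fix Z assume Z: "Z \<in> ZZ"
    have cI: "c Z \<in> I" using c Z by (auto simp: ZZ_def)
    let ?x = "?m Z * (1 / p) ^ w"
    have x: "0 \<le> ?x" using p by simp
    have "(\<Sum>A\<in>AA Z. \<Sum>i\<in>II A. \<Sum>B\<in>Pow (R i). ?x) \<le> (\<Sum>A\<in>AA Z. \<Sum>i\<in>II A. 2 ^ w * ?x)"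
    proof (intro sum_mono)
      fix A i assume "i \<in> II A"
      hence i: "i \<in> I" by (simp add: II_def)
      have "(2::real) ^ card (R i) \<le> 2 ^ w" using Rw[OF i] by simp
      thus "(\<Sum>B\<in>Pow (R i). ?x) \<le> 2 ^ w * ?x"
        using x by (simp add: card_Pow[OF finR[OF i]] mult_right_mono del: times_divide_eq_right)
    qed
    also have "\<dots> = (\<Sum>A\<in>AA Z. real (card (II A)) * (2 ^ w * ?x))" by simp
    also have "\<dots> \<le> (\<Sum>A\<in>AA Z. (q ^ Suc w' * M) * (2 ^ w * ?x))"
    proof (intro sum_mono mult_right_mono)
      fix A assume "A \<in> AA Z"
      hence "Suc w' \<le> card A" by (simp add: AA_def)
      hence "q ^ card A \<le> q ^ Suc w'" using q by (intro power_decreasing) auto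
      hence "q ^ card A * M \<le> q ^ Suc w' * M" using M by (rule mult_right_mono)
      thus "real (card (II A)) \<le> q ^ Suc w' * M"
        using spread[of A] unfolding II_def by linarith
    qed (use x in auto)
    also have "\<dots> = real (card (AA Z)) * ((q ^ Suc w' * M) * (2 ^ w * ?x))" by simp
    also have "\<dots> \<le> 2 ^ w * ((q ^ Suc w' * M) * (2 ^ w * ?x))"
    proof (rule mult_right_mono)
      have "card (AA Z) \<le> card (Pow (R (c Z)))"
        using finR[OF cI] by (intro card_mono) (auto simp: AA_def)
      also have "\<dots> = 2 ^ card (R (c Z))" using finR[OF cI] by (simp add: card_Pow)
      also have "\<dots> \<le> 2 ^ w" using Rw[OF cI] by simp
      finally show "real (card (AA Z)) \<le> 2 ^ w" by (metis of_nat_le_iff of_nat_numeral of_nat_power)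
    qed (use x q M in auto)
    also have "\<dots> = ?m Z * ((4 / p) ^ w * q ^ Suc w' * M)"
    proof -
      \<comment> \<open>One factor \<open>2 ^ w\<close> counts the sets \<open>A\<close>, the other
        the sets \<open>B\<close>.\<close>
      have "(4 / p) ^ w = 2 ^ w * 2 ^ w * (1 / p) ^ w"
        by (simp add: power_mult_distrib[symmetric])
      thus ?thesis by (simp only: mult_ac)
    qed
    finally show "(\<Sum>A\<in>AA Z. \<Sum>i\<in>II A. \<Sum>B\<in>Pow (R i). ?x) \<le> \<dots>" .
  qed
  also have "\<dots> = (\<Sum>Z\<in>ZZ. ?m Z) * ((4 / p) ^ w * q ^ Suc w' * M)"
    by (simp add: sum_distrib_right)
  also have "\<dots> \<le> 1 * ((4 / p) ^ w * q ^ Suc w' * M)"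
  proof (rule mult_right_mono)
    have "(\<Sum>Z\<in>ZZ. ?m Z) \<le> (\<Sum>Z\<in>Pow X. ?m Z)"
      using X by (intro sum_mono2) (auto simp: ZZ_def)
    thus "(\<Sum>Z\<in>ZZ. ?m Z) \<le> 1" using sum_pmf_random_subset[OF X] by simp
  qed (use p q M in auto)
  finally show ?thesis by (simp add: bad_def)
qed

text \<open>
  After each round a surviving index \<open>i\<close> receives the residual set \<open>R j - W\<close> of a witness \<open>j\<close>. Since
  this is a subset of \<open>R i\<close>, the spread hypothesis is inherited with the same \<open>q\<close> and \<open>M\<close>.
\<close>

lemma prob_contains_no_member_le:
  fixes R :: "'i \<Rightarrow> 'e set" and p q M \<delta> :: real and step :: "nat \<Rightarrow> nat"
  assumes X: "finite X" and p: "0 < p" "p \<le> 1" and q: "0 < q" "q \<le> 1" and M: "0 < M" and d: "0 \<le> \<delta>"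
    and step: "\<And>w. 0 < w \<Longrightarrow> (4 / p) ^ w * q ^ Suc (step w) \<le> \<delta>"
    and "finite I" "\<And>i. i \<in> I \<Longrightarrow> R i \<subseteq> X" "\<And>i. i \<in> I \<Longrightarrow> card (R i) \<le> w"
    and "\<And>S. real (card {i \<in> I. S \<subseteq> R i}) \<le> q ^ card S * M"
    and "(step ^^ k) w = 0"
  shows "measure_pmf.prob (random_subset X (1 - (1 - p) ^ k)) {W. \<not> (\<exists>i\<in>I. R i \<subseteq> W)}
          \<le> 1 - real (card I) / M + real k * \<delta>"
  using assms(9-)
proof (induction k arbitrary: w I R)
  case (0 w I R)
  show ?case
  proof (cases "I = {}")
    case False
    then obtain i where i: "i \<in> I" by auto
    with 0 have "R i = {}" using X finite_subset by (metis bot_nat_0.extremum_uniqueI card_0_eq funpow_0)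
    hence "{W. \<not> (\<exists>i\<in>I. R i \<subseteq> W)} = {}" using i by auto
    \<comment> \<open>The spread hypothesis at the empty set keeps the right-hand side
      nonnegative.\<close>
    moreover have "real (card I) \<le> M" using 0(4)[of "{}"] by simp
    ultimately show ?thesis using M by simp
  qed simp
next
  case (Suc k w I R)
  show ?case
  \<comment> \<open>A size bound that is already 0 is treated apart, because the estimate by
    \<open>\<delta>\<close> is available for positive sizes only.\<close>
  proof (cases "w = 0")
    case True
    show ?thesis
    proof (cases "I = {}")
      case False
      then obtain i where i: "i \<in> I" by auto
      with Suc True have "R i = {}" using X finite_subset by (metis bot_nat_0.extremum_uniqueI card_0_eq)
      hence "{W. \<not> (\<exists>i\<in>I. R i \<subseteq> W)} = {}" using i by auto
      moreover have "real (card I) \<le> M" using Suc(5)[of "{}"] by simp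
      ultimately show ?thesis using M d by simp
    qed (use d in \<open>auto intro: order_trans[OF measure_pmf.prob_le_1]\<close>)
  next
    case False
    let ?m = "pmf (random_subset X p)" and ?pk = "1 - (1 - p) ^ k"
    let ?U = "{W. \<not> (\<exists>i\<in>I. R i \<subseteq> W)}"
    define bad where "bad W = {i \<in> I. \<not> (\<exists>j\<in>I. R j - W \<subseteq> R i \<and> card (R j - W) \<le> step w)}" for W
    have pk: "0 \<le> ?pk" "?pk \<le> 1" using p by (auto simp: power_le_one)
    \<comment> \<open>The first round has density \<open>p\<close>; the other \<open>k\<close>
      rounds together have density \<open>?pk\<close>.\<close>
    have eq: "1 - (1 - p) ^ Suc k = p + ?pk - p * ?pk" by (simp add: algebra_simps)
    \<comment> \<open>Given the outcome \<open>A\<close> of the first round, the indices in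
      \<open>bad A\<close> are discarded, and each of them costs \<open>1 / M\<close> in the bound
      for the remaining rounds.\<close>
    have round: "measure_pmf.prob (random_subset X ?pk) {B. A \<union> B \<in> ?U}
        \<le> 1 - real (card I) / M + real k * \<delta> + real (card (bad A)) / M" if "A \<subseteq> X" for A
    proof -
      define J where "J = I - bad A"
      define c where "c i = (SOME j. j \<in> I \<and> R j - A \<subseteq> R i \<and> card (R j - A) \<le> step w)" for i
      have c: "c i \<in> I \<and> R (c i) - A \<subseteq> R i \<and> card (R (c i) - A) \<le> step w" if "i \<in> J" for i
        unfolding c_def by (rule someI_ex) (use that in \<open>auto simp: J_def bad_def\<close>)
      define R' where "R' i = R (c i) - A" for i
      have JI: "J \<subseteq> I" by (auto simp: J_def)
      have R'X: "R' i \<subseteq> X" if "i \<in> J" for i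
        using c[OF that] Suc.prems(2) by (auto simp: R'_def)
      have "real (card {i \<in> J. S \<subseteq> R' i}) \<le> q ^ card S * M" for S
      proof -
        have "card {i \<in> J. S \<subseteq> R' i} \<le> card {i \<in> I. S \<subseteq> R i}"
          using c JI Suc.prems(1) unfolding R'_def by (intro card_mono) auto
        thus ?thesis using Suc.prems(4)[of S] by linarith
      qed
      hence "measure_pmf.prob (random_subset X ?pk) {W. \<not> (\<exists>i\<in>J. R' i \<subseteq> W)}
          \<le> 1 - real (card J) / M + real k * \<delta>"
        using Suc.prems c R'X finite_subset[OF JI]
        by (intro Suc.IH[where w = "step w"]) (simp_all add: R'_def funpow_swap1)
      \<comment> \<open>A residual set inside \<open>B\<close> completes to a full member
        \<open>R (c i)\<close> inside \<open>A \<union> B\<close>.\<close>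
      moreover have "{B. A \<union> B \<in> ?U} \<subseteq> {W. \<not> (\<exists>i\<in>J. R' i \<subseteq> W)}"
        using c unfolding R'_def by blast
      hence "measure_pmf.prob (random_subset X ?pk) {B. A \<union> B \<in> ?U}
         \<le> measure_pmf.prob (random_subset X ?pk) {W. \<not> (\<exists>i\<in>J. R' i \<subseteq> W)}"
        by (intro measure_pmf.finite_measure_mono) auto
      moreover have "real (card J) = real (card I) - real (card (bad A))"
        using Suc.prems(1) unfolding J_def
        by (subst card_Diff_subset) (auto simp: bad_def of_nat_diff card_mono)
      ultimately show ?thesis using M by (simp add: diff_divide_distrib)
    qed
    \<comment> \<open>The expected number of discarded indices is at most
      \<open>\<delta> * M\<close>, so on average the round costs \<open>\<delta>\<close>.\<close>
    have one: "(\<Sum>A\<in>Pow X. ?m A * real (card (bad A))) \<le> \<delta> * M"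
    proof -
      have "(\<Sum>A\<in>Pow X. ?m A * real (card (bad A))) \<le> (4 / p) ^ w * q ^ Suc (step w) * M"
        unfolding bad_def using Suc.prems M by (intro expected_card_bad_le X p q) auto
      also have "\<dots> \<le> \<delta> * M" using step[of w] False M by (intro mult_right_mono) auto
      finally show ?thesis .
    qed
    have "measure_pmf.prob (random_subset X (1 - (1 - p) ^ Suc k)) ?U
       = (\<Sum>A\<in>Pow X. ?m A * measure_pmf.prob (random_subset X ?pk) {B. A \<union> B \<in> ?U})"
      unfolding eq using p pk X by (intro prob_random_subset_union) auto
    also have "\<dots> \<le> (\<Sum>A\<in>Pow X. ?m A * (1 - real (card I) / M + real k * \<delta> + real (card (bad A)) / M))"
      using round by (intro sum_mono mult_left_mono) auto
    also have "\<dots> = (\<Sum>A\<in>Pow X. ?m A) * (1 - real (card I) / M + real k * \<delta>)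
        + (\<Sum>A\<in>Pow X. ?m A * real (card (bad A))) / M"
      by (simp add: sum_distrib_right sum_divide_distrib distrib_left sum.distrib)
    also have "\<dots> \<le> 1 - real (card I) / M + real (Suc k) * \<delta>"
      using one M unfolding sum_pmf_random_subset[OF X] by (simp add: divide_simps algebra_simps)
    finally show ?thesis .
  qed
qed

subsection \<open>Random copies of a tree are spread\<close>

text \<open>The falling factorial \<open>n! / (n - v)!\<close> is \<open>(n choose v) * v!\<close>.
  The lower bounds \<open>(n / v) ^ v\<close> for the binomial coefficient and
  \<open>(v / e) ^ v\<close> for \<open>v!\<close> multiply to \<open>(n / e) ^ v\<close>.\<close>

lemma fact_diff_le:
  assumes "v \<le> n" "0 < n"
  shows "(fact (n - v) :: real) \<le> fact n * (exp 1 / real n) ^ v"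
proof (cases "v = 0")
  case False
  have "(\<Sum>k\<in>{v}. inverse (fact k) * real v ^ k) \<le> (\<Sum>k. inverse (fact k) * real v ^ k)"
    by (intro sum_le_suminf summable_exp) auto
  hence "real v ^ v / fact v \<le> exp (real v)"
    by (simp add: exp_def divide_inverse mult.commute)
  hence 1: "real v ^ v \<le> exp 1 ^ v * fact v"
    using exp_of_nat_mult[of v "1::real"] by (simp add: divide_simps)
  have 2: "(real n / real v) ^ v \<le> real (n choose v)"
    using binomial_ge_n_over_k_pow_k[OF assms(1), where 'a = real] by simp
  have 3: "(fact n :: real) = real (n choose v) * fact v * fact (n - v)"
    using binomial_fact[OF assms(1), where 'a = real] by simp
  have "real n ^ v = (real n / real v) ^ v * real v ^ v"
    using False by (simp add: power_divide)
  also have "\<dots> \<le> real (n choose v) * (exp 1 ^ v * fact v)"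
    using 1 2 by (intro mult_mono) auto
  finally have "real n ^ v * fact (n - v) \<le> real (n choose v) * (exp 1 ^ v * fact v) * fact (n - v)"
    by (intro mult_right_mono) auto
  also have "\<dots> = fact n * exp 1 ^ v" by (simp add: 3)
  finally show ?thesis using assms(2) by (simp add: power_divide field_simps)
qed simp

text \<open>\<open>D\<close> is a forest of parent-child pairs: injectivity of \<open>snd\<close>
  gives each vertex at most one parent, and \<open>dep\<close> excludes cycles. Induction removes a
  pair whose child \<open>b\<close> is deepest; \<open>b\<close> occurs in no other pair and has at
  most \<open>d\<close> images once its parent is placed. The \<open>card U - card D\<close> roots
  are placed freely.\<close>

lemma card_forest_maps:
  fixes D :: "('a \<times> 'a) set" and C :: "'b \<Rightarrow> 'b set" and dep :: "'a \<Rightarrow> nat"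
  assumes V: "finite V" and U: "finite U" and D: "D \<subseteq> U \<times> U"
    and inj: "inj_on snd D" and dep: "\<And>a b. (a, b) \<in> D \<Longrightarrow> dep a < dep b"
    and C: "\<And>y. y \<in> V \<Longrightarrow> C y \<subseteq> V \<and> card (C y) \<le> d"
  shows "card {f \<in> U \<rightarrow>\<^sub>E V. \<forall>(a, b)\<in>D. f b \<in> C (f a)} \<le> card V ^ (card U - card D) * d ^ card D"
  using U D inj dep
proof (induction "card D" arbitrary: D U)
  case 0
  hence "D = {}" by (metis card_0_eq finite_SigmaI finite_subset)
  thus ?case using V 0 by (simp add: card_PiE)
next
  case (Suc k D U)
  have finD: "finite D" using Suc.prems(1,2) finite_subset by blast
  have "D \<noteq> {}" using Suc.hyps(2) by auto
  hence "Max ((\<lambda>x. dep (snd x)) ` D) \<in> (\<lambda>x. dep (snd x)) ` D"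
    using finD by (intro Max_in) auto
  then obtain a b where ab: "(a, b) \<in> D" and "dep b = Max ((\<lambda>x. dep (snd x)) ` D)"
    by force
  hence max: "dep (snd x) \<le> dep b" if "x \<in> D" for x using finD that by simp
  define D' where "D' = D - {(a, b)}"
  define U' where "U' = U - {b}"
  have bU: "a \<in> U" "b \<in> U" using ab Suc.prems(2) by auto
  have nb: "x \<noteq> b \<and> y \<noteq> b" if "(x, y) \<in> D'" for x y
  proof
    have "dep x < dep y" using that Suc.prems(4) by (auto simp: D'_def)
    thus "x \<noteq> b" using max[of "(x, y)"] that by (auto simp: D'_def)
    show "y \<noteq> b" using that ab inj_onD[OF Suc.prems(3), of "(x, y)" "(a, b)"] by (auto simp: D'_def)
  qed
  have anb: "a \<noteq> b" using Suc.prems(4)[OF ab] by auto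
  have cD': "card D' = k" using Suc.hyps(2) ab finD by (simp add: D'_def)
  let ?F = "{f \<in> U \<rightarrow>\<^sub>E V. \<forall>(a, b)\<in>D. f b \<in> C (f a)}"
  let ?F' = "{f \<in> U' \<rightarrow>\<^sub>E V. \<forall>(a, b)\<in>D'. f b \<in> C (f a)}"
  have IH: "card ?F' \<le> card V ^ (card U' - card D') * d ^ card D'"
  proof (rule Suc.hyps(1))
    show "k = card D'" by (simp add: cD')
    show "finite U'" using Suc.prems(1) by (simp add: U'_def)
    show "D' \<subseteq> U' \<times> U'" using Suc.prems(2) nb by (auto simp: U'_def D'_def)
    show "inj_on snd D'" using Suc.prems(3) by (rule inj_on_subset) (auto simp: D'_def)
  qed (use Suc.prems(4) in \<open>auto simp: D'_def\<close>)
  have finF': "finite ?F'" using V Suc.prems(1) by (intro finite_Collect_conjI disjI1) (simp add: finite_PiE U'_def)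
  have finC: "finite (C y)" if "y \<in> V" for y using C[OF that] V finite_subset by blast
  let ?h = "\<lambda>f. (restrict f U', f b)"
  have "card ?F \<le> card (Sigma ?F' (\<lambda>f. C (f a)))"
  proof (rule card_inj_on_le)
    show "inj_on ?h ?F"
    proof (rule inj_onI)
      fix f g assume f: "f \<in> ?F" and g: "g \<in> ?F" and "?h f = ?h g"
      hence eq: "restrict f U' = restrict g U'" "f b = g b" by auto
      show "f = g"
      proof (rule PiE_ext[of f U "\<lambda>_. V" g])
        fix x assume "x \<in> U"
        thus "f x = g x"
          using eq(2) fun_cong[OF eq(1), of x] by (cases "x = b") (simp_all add: U'_def)
      qed (use f g in auto)
    qed
    show "?h ` ?F \<subseteq> Sigma ?F' (\<lambda>f. C (f a))"
    proof (rule image_subsetI)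
      fix f assume f: "f \<in> ?F"
      have "restrict f U' \<in> U' \<rightarrow>\<^sub>E V" using f by (auto simp: U'_def)
      moreover have "restrict f U' y \<in> C (restrict f U' x)" if "(x, y) \<in> D'" for x y
        using f nb[OF that] that Suc.prems(2) by (auto simp: U'_def D'_def)
      ultimately have "restrict f U' \<in> ?F'" by blast
      moreover have "f b \<in> C (restrict f U' a)" using f ab anb bU by (auto simp: U'_def)
      ultimately show "?h f \<in> Sigma ?F' (\<lambda>f. C (f a))" by (rule SigmaI[where B = "\<lambda>f. C (f a)"])
    qed
    show "finite (Sigma ?F' (\<lambda>f. C (f a)))"
      using finF' bU anb by (intro finite_SigmaI finC) (auto simp: U'_def)
  qed
  also have "\<dots> = (\<Sum>f\<in>?F'. card (C (f a)))"
    using finF' bU anb by (intro card_SigmaI ballI finC) (auto simp: U'_def)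
  also have "\<dots> \<le> (\<Sum>f\<in>?F'. d)"
    using C bU anb by (intro sum_mono) (auto simp: U'_def)
  also have "\<dots> = card ?F' * d" by simp
  also have "\<dots> \<le> card V ^ (card U' - card D') * d ^ card D' * d"
    using IH by (intro mult_right_mono) auto
  also have "card U' - card D' = card U - card D"
    using Suc.hyps(2) Suc.prems(1) bU cD' by (simp add: U'_def)
  also have "card V ^ (card U - card D) * d ^ card D' * d = card V ^ (card U - card D) * d ^ card D"
    using cD' Suc.hyps(2)[symmetric] by simp
  finally show ?case .
qed

text \<open>Composition with the inverse of one such permutation fixes \<open>U\<close> pointwise
  and leaves a permutation of \<open>V - U\<close>.\<close>

lemma card_permutes_agreeing_on:
  assumes V: "finite V" and U: "U \<subseteq> V"
  shows "card {g. g permutes V \<and> restrict g U = f} \<le> fact (card V - card U)"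
proof (cases "{g. g permutes V \<and> restrict g U = f} = {}")
  case False
  then obtain g where g: "g permutes V" "restrict g U = f" by auto
  have "card {g. g permutes V \<and> restrict g U = f} \<le> card {h. h permutes (V - U)}"
  proof (rule card_inj_on_le[where f = "\<lambda>k. inv g \<circ> k"])
    show "inj_on (\<lambda>k. inv g \<circ> k) {g. g permutes V \<and> restrict g U = f}"
    proof (rule inj_onI)
      fix k l assume "inv g \<circ> k = inv g \<circ> l"
      hence "g \<circ> (inv g \<circ> k) = g \<circ> (inv g \<circ> l)" by simp
      thus "k = l" using permutes_inv_o(1)[OF g(1)] by (simp add: comp_assoc[symmetric])
    qed
    show "(\<lambda>k. inv g \<circ> k) ` {g. g permutes V \<and> restrict g U = f} \<subseteq> {h. h permutes (V - U)}"
    proof (rule image_subsetI)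
      fix k assume "k \<in> {g. g permutes V \<and> restrict g U = f}"
      hence k: "k permutes V" "restrict k U = restrict g U" using g by auto
      have "inv g \<circ> k permutes V"
        using k(1) permutes_inv[OF g(1)] by (rule permutes_compose)
      moreover have "(inv g \<circ> k) x = x" if "x \<in> U" for x
        using fun_cong[OF k(2), of x] that permutes_inverses(2)[OF g(1)] by simp
      ultimately have "inv g \<circ> k permutes V - U"
        by (rule permutes_superset) auto
      thus "inv g \<circ> k \<in> {h. h permutes (V - U)}" by simp
    qed
    show "finite {h. h permutes (V - U)}" using V by (intro finite_permutations) auto
  qed
  also have "\<dots> = fact (card V - card U)"
    using card_permutations[of "V - U"] V U finite_subset[OF U V] by (simp add: card_Diff_subset)
  finally show ?thesis .
next
  case True
  show ?thesis unfolding True by simp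
qed

text \<open>The permutations are grouped by their restriction to \<open>U\<close>, which is a forest
  map; each group consists of the extensions of one such map.\<close>

lemma card_permutes_forest:
  assumes V: "finite V" and U: "U \<subseteq> V" and D: "D \<subseteq> U \<times> U"
    and inj: "inj_on snd D" and dep: "\<And>a b. (a, b) \<in> D \<Longrightarrow> dep a < (dep b :: nat)"
    and C: "\<And>y. y \<in> V \<Longrightarrow> C y \<subseteq> V \<and> card (C y) \<le> d"
  shows "card {g. g permutes V \<and> (\<forall>(a, b)\<in>D. g b \<in> C (g a))}
     \<le> card V ^ (card U - card D) * d ^ card D * fact (card V - card U)"
proof -
  let ?F = "{f \<in> U \<rightarrow>\<^sub>E V. \<forall>(a, b)\<in>D. f b \<in> C (f a)}"
  let ?G = "{g. g permutes V \<and> (\<forall>(a, b)\<in>D. g b \<in> C (g a))}"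
  have fU: "finite U" using U V finite_subset by blast
  have finF: "finite ?F" using V fU by (intro finite_Collect_conjI disjI1) (simp add: finite_PiE)
  have "?G \<subseteq> (\<Union>f\<in>?F. {g. g permutes V \<and> restrict g U = f})"
  proof
    fix g assume g: "g \<in> ?G"
    have "restrict g U \<in> ?F" using g D U by (auto simp: permutes_in_image)
    thus "g \<in> (\<Union>f\<in>?F. {g. g permutes V \<and> restrict g U = f})" using g by blast
  qed
  hence "card ?G \<le> card (\<Union>f\<in>?F. {g. g permutes V \<and> restrict g U = f})"
    using finF V by (intro card_mono finite_UN_I) (auto intro: finite_subset[OF _ finite_permutations[OF V]])
  also have "\<dots> \<le> (\<Sum>f\<in>?F. card {g. g permutes V \<and> restrict g U = f})"
    using finF by (rule card_UN_le)
  also have "\<dots> \<le> (\<Sum>f\<in>?F. fact (card V - card U))"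
    by (intro sum_mono card_permutes_agreeing_on V U)
  also have "\<dots> = card ?F * fact (card V - card U)" by simp
  also have "\<dots> \<le> card V ^ (card U - card D) * d ^ card D * fact (card V - card U)"
    by (intro mult_right_mono card_forest_maps[where dep = dep] V fU D inj dep C) auto
  finally show ?thesis .
qed

text \<open>
  Orient every edge of \<open>S\<close> from parent to child (at most \<open>2 ^ card S\<close> ways) and let \<open>U = \<Union>S\<close>. The
  oriented edges form a forest with \<open>card U - card S\<close> roots, so there are at most
  \<open>n ^ (card U - card S) * d ^ card S\<close> admissible maps of \<open>U\<close> into the tree, and each of them extends
  to \<open>fact (n - card U)\<close> permutations. Finally \<open>card U \<le> 2 * card S\<close>.
\<close>

lemma random_tree_copy_spread:
  fixes par :: "'a \<Rightarrow> 'a" and dep :: "'a \<Rightarrow> nat" and S :: "'a set set"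
  assumes V: "finite V" and r: "r \<in> V"
    and par: "\<And>x. x \<in> V - {r} \<Longrightarrow> par x \<in> V \<and> dep (par x) < dep x"
    and children: "\<And>y. y \<in> V \<Longrightarrow> card {x \<in> V - {r}. par x = y} \<le> d"
  shows "real (card {\<pi>. \<pi> permutes V \<and> S \<subseteq> (\<lambda>x. {\<pi> x, \<pi> (par x)}) ` (V - {r})})
    \<le> (2 * exp 1 ^ 2 * real d / real (card V)) ^ card S * fact (card V)"
proof (cases "{\<pi>. \<pi> permutes V \<and> S \<subseteq> (\<lambda>x. {\<pi> x, \<pi> (par x)}) ` (V - {r})} = {}")
  case False
  let ?P = "{\<pi>. \<pi> permutes V \<and> S \<subseteq> (\<lambda>x. {\<pi> x, \<pi> (par x)}) ` (V - {r})}"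
  let ?n = "card V" and ?s = "card S" and ?U = "\<Union>S"
  \<comment> \<open>\<open>c\<close> orients \<open>S\<close>: it names the endpoint of each edge
    that comes from the child, and \<open>Pc c\<close> collects the copies compatible with this
    choice.\<close>
  define Pc where "Pc c = {\<pi> \<in> ?P. \<forall>s\<in>S. inv \<pi> (c s) \<in> V - {r} \<and> s = {c s, \<pi> (par (inv \<pi> (c s)))}}" for c
  define C where "C y = {x \<in> V - {r}. par x = y}" for y
  \<comment> \<open>One copy containing \<open>S\<close> suffices to see that \<open>S\<close> is
    finite and consists of 2-element subsets of \<open>V\<close>.\<close>
  from False obtain \<pi>' where \<pi>': "\<pi>' permutes V" "S \<subseteq> (\<lambda>x. {\<pi>' x, \<pi>' (par x)}) ` (V - {r})"
    by auto
  have finS: "finite S" using \<pi>'(2) V finite_subset by blast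
  have S: "s \<subseteq> V" "finite s" "card s = 2" if s: "s \<in> S" for s
  proof -
    obtain x where x: "x \<in> V - {r}" "s = {\<pi>' x, \<pi>' (par x)}" using \<pi>'(2) s by blast
    have "x \<noteq> par x" using par[OF x(1)] by auto
    hence "\<pi>' x \<noteq> \<pi>' (par x)" using permutes_inj[OF \<pi>'(1)] by (auto dest: injD)
    thus "s \<subseteq> V" "finite s" "card s = 2"
      using x par[OF x(1)] permutes_in_image[OF \<pi>'(1)] by auto
  qed
  have U: "?U \<subseteq> V" using S by auto
  hence finU: "finite ?U" using V finite_subset by blast
  have v2: "card ?U \<le> 2 * ?s"
    using card_Union_le_sum_card[of S] S by simp
  have vn: "card ?U \<le> ?n" using U V by (rule card_mono[rotated])
  have n0: "0 < ?n" using V r by (auto simp: card_gt_0_iff)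
  let ?E = "exp 1 :: real"
  define N where "N = (?E ^ 2 * real d / real ?n) ^ ?s * fact ?n"
  have Pc: "real (card (Pc c)) \<le> N" for c
  proof (cases "Pc c = {}")
    case False
    \<comment> \<open>A reference copy \<open>\<rho>\<close> fixes the parent endpoints
      \<open>o' s\<close>; depths pulled back along \<open>inv \<rho>\<close> certify that the
      oriented edges form a forest.\<close>
    then obtain \<rho> where \<rho>: "\<rho> \<in> Pc c" by auto
    define o' where "o' s = \<rho> (par (inv \<rho> (c s)))" for s
    define D where "D = (\<lambda>s. (o' s, c s)) ` S"
    have \<rho>p: "\<rho> permutes V" using \<rho> by (auto simp: Pc_def)
    have oc: "s = {c s, o' s}" if "s \<in> S" for s
      using \<rho> that by (simp add: Pc_def o'_def)
    have neq: "c s \<noteq> o' s" if "s \<in> S" for s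
      using oc[OF that] S(3)[OF that] by (metis insert_absorb2 is_singletonI is_singleton_altdef
          numeral_eq_one_iff semiring_norm(85))
    have injc: "inj_on c S"
    proof (rule inj_onI)
      fix s t assume st: "s \<in> S" "t \<in> S" "c s = c t"
      hence "o' s = o' t" by (simp add: o'_def)
      thus "s = t" using oc[OF st(1)] oc[OF st(2)] st(3) by simp
    qed
    have injD: "inj_on snd D"
      using injc by (auto simp: D_def inj_on_def)
    have cD: "card D = ?s"
      unfolding D_def using injc by (intro card_image) (auto simp: inj_on_def)
    have DU: "D \<subseteq> ?U \<times> ?U" using oc unfolding D_def by blast
    have sv: "?s \<le> card ?U"
    proof -
      have "c ` S \<subseteq> ?U" using oc by blast
      thus ?thesis using card_inj_on_le[OF injc _ finU] by blast
    qed
    \<comment> \<open>The count passes to inverses, which map the vertices of \<open>S\<close> into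
      the tree: a child endpoint must land among the children of the image of its parent
      endpoint.\<close>
    have "card (Pc c) \<le> card {g. g permutes V \<and> (\<forall>(a, b)\<in>D. g b \<in> C (g a))}"
    proof (rule card_inj_on_le)
      show "inj_on inv (Pc c)"
        by (rule inj_on_inverseI[where g = inv]) (auto simp: Pc_def permutes_inv_inv)
      show "finite {g. g permutes V \<and> (\<forall>(a, b)\<in>D. g b \<in> C (g a))}"
        by (rule finite_subset[OF _ finite_permutations[OF V]]) auto
      show "inv ` Pc c \<subseteq> {g. g permutes V \<and> (\<forall>(a, b)\<in>D. g b \<in> C (g a))}"
      proof (rule image_subsetI)
        fix \<pi> assume \<pi>: "\<pi> \<in> Pc c"
        hence \<pi>p: "\<pi> permutes V" by (simp add: Pc_def)
        have "inv \<pi> (c s) \<in> C (inv \<pi> (o' s))" if s: "s \<in> S" for s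
        proof -
          have 1: "inv \<pi> (c s) \<in> V - {r}" "s = {c s, \<pi> (par (inv \<pi> (c s)))}"
            using \<pi> s by (auto simp: Pc_def)
          hence "{c s, \<pi> (par (inv \<pi> (c s)))} = {c s, o' s}" using oc[OF s] by simp
          hence "o' s = \<pi> (par (inv \<pi> (c s)))" using neq[OF s] by (auto simp: doubleton_eq_iff)
          hence "inv \<pi> (o' s) = par (inv \<pi> (c s))"
            using permutes_inverses(2)[OF \<pi>p] by simp
          thus ?thesis using 1 by (auto simp: C_def)
        qed
        thus "inv \<pi> \<in> {g. g permutes V \<and> (\<forall>(a, b)\<in>D. g b \<in> C (g a))}"
          using permutes_inv[OF \<pi>p] by (auto simp: D_def)
      qed
    qed
    also have "\<dots> \<le> ?n ^ (card ?U - card D) * d ^ card D * fact (?n - card ?U)"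
    proof (rule card_permutes_forest[where dep = "\<lambda>a. dep (inv \<rho> a)"])
      show "C y \<subseteq> V \<and> card (C y) \<le> d" if "y \<in> V" for y
        using children[OF that] by (auto simp: C_def)
      fix a b assume "(a, b) \<in> D"
      then obtain s where s: "s \<in> S" "a = o' s" "b = c s" by (auto simp: D_def)
      have "inv \<rho> (c s) \<in> V - {r}" using \<rho> s(1) by (auto simp: Pc_def)
      thus "dep (inv \<rho> a) < dep (inv \<rho> b)"
        using s par permutes_inverses(2)[OF \<rho>p] by (simp add: o'_def)
    qed (use V U DU injD in auto)
    finally have "card (Pc c) \<le> ?n ^ (card ?U - ?s) * d ^ ?s * fact (?n - card ?U)"
      by (simp only: cD)
    hence "real (card (Pc c)) \<le> real (?n ^ (card ?U - ?s) * d ^ ?s * fact (?n - card ?U))"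
      by (simp only: of_nat_le_iff)
    also have "\<dots> = real ?n ^ (card ?U - ?s) * real d ^ ?s * fact (?n - card ?U)" by simp
    also have "\<dots> \<le> real ?n ^ (card ?U - ?s) * real d ^ ?s * (fact ?n * (?E / real ?n) ^ card ?U)"
      using fact_diff_le[OF vn n0] by (intro mult_left_mono) auto
    also have "\<dots> = real d ^ ?s / real ?n ^ ?s * fact ?n * ?E ^ card ?U"
    proof -
      have "real ?n ^ card ?U = real ?n ^ (card ?U - ?s) * real ?n ^ ?s"
        using sv by (simp add: power_add[symmetric])
      thus ?thesis using n0 by (simp add: power_divide field_simps)
    qed
    also have "\<dots> \<le> real d ^ ?s / real ?n ^ ?s * fact ?n * ?E ^ (2 * ?s)"
      using v2 by (intro mult_left_mono power_increasing) auto
    also have "\<dots> = N" by (simp add: N_def power_mult power_mult_distrib power_divide)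
    finally show ?thesis .
  qed (simp add: N_def)
  have "?P \<subseteq> (\<Union>c\<in>PiE S (\<lambda>s. s). Pc c)"
  proof
    fix \<pi> assume \<pi>: "\<pi> \<in> ?P"
    hence "\<forall>s\<in>S. \<exists>x\<in>V - {r}. s = {\<pi> x, \<pi> (par x)}" by blast
    then obtain x where x: "\<And>s. s \<in> S \<Longrightarrow> x s \<in> V - {r} \<and> s = {\<pi> (x s), \<pi> (par (x s))}"
      by metis
    have \<pi>p: "\<pi> permutes V" using \<pi> by simp
    define c where "c = restrict (\<lambda>s. \<pi> (x s)) S"
    have inv: "inv \<pi> (c s) = x s" if "s \<in> S" for s
      using that permutes_inverses(2)[OF \<pi>p] by (simp add: c_def)
    have "c \<in> PiE S (\<lambda>s. s)" using x by (auto simp: c_def)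
    moreover have "inv \<pi> (c s) \<in> V - {r} \<and> s = {c s, \<pi> (par (inv \<pi> (c s)))}" if "s \<in> S" for s
      using x[OF that] that unfolding inv[OF that] by (simp add: c_def)
    hence "\<pi> \<in> Pc c" using \<pi> by (simp add: Pc_def)
    ultimately show "\<pi> \<in> (\<Union>c\<in>PiE S (\<lambda>s. s). Pc c)" by blast
  qed
  moreover have finPi: "finite (PiE S (\<lambda>s. s))" using finS S by (intro finite_PiE) auto
  moreover have "finite (Pc c)" for c
    by (rule finite_subset[OF _ finite_permutations[OF V]]) (auto simp: Pc_def)
  ultimately have "card ?P \<le> card (\<Union>c\<in>PiE S (\<lambda>s. s). Pc c)"
    by (intro card_mono finite_UN_I) auto
  also have "\<dots> \<le> (\<Sum>c\<in>PiE S (\<lambda>s. s). card (Pc c))"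
    using finPi by (rule card_UN_le)
  finally have "real (card ?P) \<le> (\<Sum>c\<in>PiE S (\<lambda>s. s). real (card (Pc c)))"
    by (simp only: of_nat_sum[symmetric] of_nat_le_iff)
  also have "\<dots> \<le> (\<Sum>c\<in>PiE S (\<lambda>s. s). N)" by (intro sum_mono Pc)
  also have "\<dots> = 2 ^ ?s * N" using finS S by (simp add: card_PiE)
  also have "\<dots> = (2 * exp 1 ^ 2 * real d / real ?n) ^ ?s * fact ?n"
    by (simp add: N_def power_mult_distrib power_divide)
  finally show ?thesis .
next
  case True
  show ?thesis unfolding True by simp
qed

subsection \<open>Rooted trees\<close>

text \<open>Induction along the walk: when the next vertex already occurs, the path is cut back to
  it.\<close>

lemma rtranclp_imp_distinct_path:
  assumes "R\<^sup>*\<^sup>* x y"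
  shows "\<exists>xs. xs \<noteq> [] \<and> hd xs = x \<and> last xs = y \<and> distinct xs \<and> successively R xs"
  using assms
proof induction
  case base
  show ?case by (intro exI[of _ "[x]"]) simp
next
  case (step y z)
  then obtain xs where xs: "xs \<noteq> []" "hd xs = x" "last xs = y" "distinct xs" "successively R xs"
    by blast
  show ?case
  proof (cases "z \<in> set xs")
    case True
    then obtain as bs where "xs = as @ z # bs" by (meson split_list)
    hence "xs = (as @ [z]) @ bs" by simp
    with xs show ?thesis
      by (intro exI[of _ "as @ [z]"]) (auto simp: successively_append_iff hd_append split: if_splits)
  next
    case False
    with xs step show ?thesis
      by (intro exI[of _ "xs @ [z]"]) (auto simp: successively_append_iff)
  qed
qed

text \<open>\<open>dep\<close> is the distance from \<open>r\<close>, and \<open>par x\<close> is a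
  neighbour of \<open>x\<close> closer to the root. Acyclicity shows that every edge joins a vertex
  to its parent.\<close>

lemma tree_parent_function:
  assumes T: "is_tree T" and r: "r \<in> verts T"
  obtains par and dep :: "'a \<Rightarrow> nat" where
    "\<And>x. x \<in> verts T - {r} \<Longrightarrow> par x \<in> verts T \<and> dep (par x) < dep x \<and> {x, par x} \<in> edges T"
    "\<And>e. e \<in> edges T \<Longrightarrow> \<exists>x\<in>verts T - {r}. e = {x, par x}"
proof -
  let ?V = "verts T" and ?A = "adjacent T"
  define dep where "dep x = (LEAST k. (?A ^^ k) r x)" for x
  have eV: "e \<subseteq> ?V \<and> card e = 2" if "e \<in> edges T" for e
    using T that by (auto simp: is_tree_def simple_graph_def pairs_def)
  have "\<exists>y. y \<in> ?V \<and> dep y < dep x \<and> {x, y} \<in> edges T" if x: "x \<in> ?V - {r}" for x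
  proof -
    have "?A\<^sup>*\<^sup>* r x" using T r x by (auto simp: is_tree_def connected_graph_def)
    then obtain n where "(?A ^^ n) r x" by (auto simp: rtranclp_power)
    hence d: "(?A ^^ dep x) r x" unfolding dep_def by (rule LeastI)
    have "dep x \<noteq> 0"
    proof
      assume "dep x = 0"
      with d show False using x by simp
    qed
    then obtain k where k: "dep x = Suc k" using not0_implies_Suc by blast
    then obtain y where y: "(?A ^^ k) r y" "?A y x" using d by auto
    have "dep y \<le> k" unfolding dep_def using y(1) by (rule Least_le)
    moreover have e: "{x, y} \<in> edges T" using y(2) by (simp add: adjacent_def insert_commute)
    moreover have "y \<in> ?V" using eV[OF e] by simp
    ultimately show ?thesis using k by auto
  qed
  then obtain par where par:
    "\<And>x. x \<in> ?V - {r} \<Longrightarrow> par x \<in> ?V \<and> dep (par x) < dep x \<and> {x, par x} \<in> edges T"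
    by metis
  txt \<open>An edge outside \<open>P\<close> would close a path through the root to a cycle.\<close>
  define P where "P x y \<longleftrightarrow> (x \<in> ?V - {r} \<and> y = par x) \<or> (y \<in> ?V - {r} \<and> x = par y)" for x y
  have symP: "P y x" if "P x y" for x y using that by (auto simp: P_def)
  have PA: "?A x y" if "P x y" for x y
    using that par unfolding P_def adjacent_def by (metis insert_commute)
  have to_root: "P\<^sup>*\<^sup>* x r" if "x \<in> ?V" for x
    using that
  proof (induction "dep x" arbitrary: x rule: less_induct)
    case less
    show ?case
    proof (cases "x = r")
      case False
      with less par[of x] have "P\<^sup>*\<^sup>* (par x) r" "P x (par x)" by (auto simp: P_def)
      thus ?thesis by (simp add: converse_rtranclp_into_rtranclp)
    qed simp
  qed
  have from_root: "P\<^sup>*\<^sup>* r x" if "x \<in> ?V" for x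
    using to_root[OF that] symP by (metis sympD sympI symp_rtranclp)
  have "\<exists>x\<in>?V - {r}. e = {x, par x}" if e: "e \<in> edges T" for e
  proof (rule ccontr)
    assume neg: "\<not> (\<exists>x\<in>?V - {r}. e = {x, par x})"
    obtain u v where uv: "e = {u, v}" "u \<noteq> v" using eV[OF e] by (auto simp: card_2_iff)
    have nP: "\<not> P u v" using neg uv by (auto simp: P_def insert_commute)
    have "P\<^sup>*\<^sup>* u v"
      using to_root from_root eV[OF e] uv by (meson insert_subset rtranclp_trans)
    then obtain c where c: "c \<noteq> []" "hd c = u" "last c = v" "distinct c" "successively P c"
      using rtranclp_imp_distinct_path by metis
    \<comment> \<open>A path with one vertex would give \<open>u = v\<close>, and one with two
      vertices would give \<open>P u v\<close>.\<close>
    have len: "length c \<ge> 3"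
    proof (rule ccontr)
      assume "\<not> length c \<ge> 3"
      hence "length c = 0 \<or> length c = 1 \<or> length c = 2" by linarith
      thus False
        using c uv(2) nP by (auto simp: length_Suc_conv numeral_2_eq_2)
    qed
    have "adjacent T (c ! i) (c ! (Suc i mod length c))" if i: "i < length c" for i
    proof (cases "Suc i = length c")
      case True
      hence "c ! i = v" "c ! (Suc i mod length c) = u"
        using c by (auto simp: last_conv_nth hd_conv_nth simp flip: True)
      thus ?thesis using e uv by (simp add: adjacent_def insert_commute)
    next
      case False
      thus ?thesis using c(5) i PA by (auto simp: successively_conv_nth)
    qed
    hence "is_cycle T c" using c len by (simp add: is_cycle_def)
    thus False using T by (auto simp: is_tree_def)
  qed
  with par that show ?thesis by blast
qed

text \<open>The tree is transported to \<open>{..<n}\<close>, the vertex set of \<open>gnp\<close>,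
  so that permutations of that set index its copies. Children of \<open>y\<close> inject into the
  edges at \<open>h y\<close>, hence the bound \<open>d\<close>.\<close>

lemma rooted_tree_numbering:
  assumes T: "is_tree T" and n: "card (verts T) = n" and d: "max_degree T \<le> d"
  obtains h :: "nat \<Rightarrow> 'a" and r par dep where
    "bij_betw h {..<n} (verts T)" "r < n"
    "\<And>x. x \<in> {..<n} - {r} \<Longrightarrow> par x \<in> {..<n} \<and> (dep (par x) :: nat) < dep x"
    "\<And>y. y \<in> {..<n} \<Longrightarrow> card {x \<in> {..<n} - {r}. par x = y} \<le> d"
    "\<And>e. e \<in> edges T \<Longrightarrow> \<exists>x\<in>{..<n} - {r}. e = {h x, h (par x)}"
proof -
  let ?V = "verts T"
  have fin: "finite ?V" "finite (edges T)" "?V \<noteq> {}"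
    using T finite_subset[OF _ finite_pairs[of ?V]]
    by (auto simp: is_tree_def simple_graph_def connected_graph_def)
  then obtain r where r: "r \<in> ?V" by auto
  obtain par and dep :: "'a \<Rightarrow> nat" where
    par: "\<And>x. x \<in> ?V - {r} \<Longrightarrow> par x \<in> ?V \<and> dep (par x) < dep x \<and> {x, par x} \<in> edges T"
    and edge: "\<And>e. e \<in> edges T \<Longrightarrow> \<exists>x\<in>?V - {r}. e = {x, par x}"
    using tree_parent_function[OF T r] by metis
  obtain h :: "nat \<Rightarrow> 'a" where h: "bij_betw h {..<n} ?V"
    using ex_bij_betw_nat_finite[OF fin(1)] n by (auto simp: atLeast0LessThan)
  let ?g = "inv_into {..<n} h"
  have g: "bij_betw ?g ?V {..<n}" by (rule bij_betw_inv_into[OF h])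
  have hg: "h (?g x) = x" if "x \<in> ?V" for x using h that by (simp add: bij_betw_inv_into_right)
  have gh: "?g (h x) = x" if "x < n" for x using h that by (simp add: bij_betw_inv_into_left)
  have hV: "h x \<in> ?V - {r}" if "x \<in> {..<n} - {?g r}" for x
    using that gh h by (auto simp: bij_betw_def)
  have gn: "?g x < n" if "x \<in> ?V" for x using g that by (auto simp: bij_betw_def)
  show ?thesis
  proof (rule that[of h "?g r" "\<lambda>x. ?g (par (h x))" "\<lambda>x. dep (h x)"])
    fix x assume "x \<in> {..<n} - {?g r}"
    with par[OF hV[OF this]] gn hg
    show "?g (par (h x)) \<in> {..<n} \<and> dep (h (?g (par (h x)))) < dep (h x)" by auto
  next
    fix y assume y: "y \<in> {..<n}"
    hence hy: "h y \<in> ?V" using h by (auto simp: bij_betw_def)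
    have "card {x \<in> {..<n} - {?g r}. ?g (par (h x)) = y} \<le> card {e \<in> edges T. h y \<in> e}"
    proof (rule card_inj_on_le[where f = "\<lambda>x. {h x, h y}"])
      show "inj_on (\<lambda>x. {h x, h y}) {x \<in> {..<n} - {?g r}. ?g (par (h x)) = y}"
        using h by (auto simp: inj_on_def bij_betw_def doubleton_eq_iff)
      show "(\<lambda>x. {h x, h y}) ` {x \<in> {..<n} - {?g r}. ?g (par (h x)) = y} \<subseteq> {e \<in> edges T. h y \<in> e}"
        using par hV hg by fastforce
    qed (use fin in auto)
    also have "\<dots> \<le> max_degree T"
      unfolding max_degree_def vertex_degree_def[symmetric] using fin hy by (intro Max_ge) auto
    finally show "card {x \<in> {..<n} - {?g r}. ?g (par (h x)) = y} \<le> d" using d by simp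
  next
    fix e assume "e \<in> edges T"
    then obtain x where x: "x \<in> ?V - {r}" "e = {x, par x}" using edge by blast
    have "?g x \<noteq> ?g r" using x(1) hg[of x] hg[OF r] by auto
    thus "\<exists>x\<in>{..<n} - {?g r}. e = {h x, h (?g (par (h x)))}"
      using x par[OF x(1)] hg gn by (intro bexI[of _ "?g x"]) auto
  qed (use h gn r in auto)
qed

subsection \<open>Choice of parameters\<close>

text \<open>
  Round by round the size bound \<open>w\<close> is lowered to \<open>w - 1 - w div L\<close>. With \<open>L \<ge> ln n\<close> the loss is so small
  that a factor \<open>q \<ge> 1 / n\<close> for each of the \<open>w div L\<close> missing elements costs only \<open>exp w\<close> in total.
\<close>

lemma shrink_iterate_le:
  fixes L :: nat
  assumes "0 < L"
  shows "real (((\<lambda>w. w - 1 - w div L) ^^ k) w) \<le> real w * (1 - 1 / real L) ^ k"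
proof (induction k)
  case (Suc k)
  let ?w = "((\<lambda>w. w - 1 - w div L) ^^ k) w"
  have L: "0 \<le> 1 - 1 / real L" using assms by simp
  have "?w < L * (?w div L) + L"
    using assms by (metis div_mult_mod_eq mod_less_divisor mult.commute nat_add_left_cancel_less)
  hence "real ?w < real (L * (?w div L) + L)" by (simp only: of_nat_less_iff)
  \<comment> \<open>Subtracting 1 besides \<open>w div L\<close> makes up for the rounding down, so
    each step loses at least a fraction \<open>1 / L\<close>.\<close>
  hence "real ?w / real L < real (?w div L) + 1"
    using assms by (simp add: divide_simps mult.commute distrib_left)
  moreover have "real (?w - 1 - ?w div L) = real ?w - 1 - real (?w div L) \<or> ?w - 1 - ?w div L = 0"
    by linarith
  moreover have "0 \<le> real ?w * (1 - 1 / real L)" using L by simp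
  ultimately have "real (?w - 1 - ?w div L) \<le> real ?w * (1 - 1 / real L)"
    by (auto simp: algebra_simps)
  also have "\<dots> \<le> real w * (1 - 1 / real L) ^ k * (1 - 1 / real L)"
    using Suc.IH L by (rule mult_right_mono)
  finally show ?case by (simp add: mult_ac)
qed simp

text \<open>\<open>(1 - 1 / L) ^ k\<close> is at most \<open>exp (- k / L)\<close>, hence below
  \<open>1 / n\<close>, and a natural number below 1 is 0.\<close>

lemma shrink_iterate_eq_0:
  assumes "0 < n" "0 < L" "real L * ln (real n) < real k"
  shows "((\<lambda>w. w - 1 - w div L) ^^ k) n = 0"
proof -
  have "(1 - 1 / real L) ^ k \<le> exp (- 1 / real L) ^ k"
    using assms exp_ge_add_one_self[of "- 1 / real L"] by (intro power_mono) auto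
  also have "\<dots> = exp (- (real k / real L))"
    by (simp add: exp_of_nat_mult[symmetric])
  also have "\<dots> < exp (- ln (real n))"
    using assms by (simp add: field_simps)
  also have "\<dots> = 1 / real n" using assms by (simp add: exp_minus inverse_eq_divide)
  finally have "real n * (1 - 1 / real L) ^ k < 1" using assms by (simp add: field_simps)
  with shrink_iterate_le[OF assms(2), of k n]
  have "real (((\<lambda>w. w - 1 - w div L) ^^ k) n) < 1" by linarith
  thus ?thesis by simp
qed

lemma shrink_weight:
  fixes q :: real
  assumes "0 < w" "2 \<le> L" "1 / real n \<le> q" "0 < n" "ln (real n) \<le> real L"
  shows "q ^ Suc (w - 1 - w div L) \<le> (exp 1 * q) ^ w"
proof -
  have q: "0 < q" using assms by (smt (verit) of_nat_0_less_iff zero_less_divide_1_iff)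
  have "w div L \<le> w div 2" using assms by (intro div_le_mono2) auto
  \<comment> \<open>\<open>2 \<le> L\<close> keeps the truncated subtraction exact, so the exponent
    is \<open>w - w div L\<close>.\<close>
  hence le: "Suc (w div L) \<le> w" using assms by linarith
  hence e: "w = Suc (w - 1 - w div L) + w div L" by simp
  have "ln (real n) * real (w div L) \<le> real L * real (w div L)"
    using assms by (intro mult_right_mono) auto
  also have "\<dots> \<le> real w" by (metis of_nat_le_iff of_nat_mult times_div_less_eq_dividend)
  finally have "exp (- real w) \<le> exp (- (real (w div L) * ln (real n)))" by (simp add: mult.commute)
  also have "\<dots> = (1 / real n) ^ (w div L)"
    using assms by (simp add: exp_minus exp_of_nat_mult power_one_over inverse_eq_divide)
  also have "\<dots> \<le> q ^ (w div L)" using assms by (intro power_mono) auto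
  finally have "exp (- real w) * exp (real w) \<le> q ^ (w div L) * exp (real w)"
    by (intro mult_right_mono) auto
  hence 1: "1 \<le> q ^ (w div L) * exp 1 ^ w"
    by (simp add: exp_minus exp_of_nat_mult[symmetric])
  have "q ^ Suc (w - 1 - w div L) * 1 \<le> q ^ Suc (w - 1 - w div L) * (q ^ (w div L) * exp 1 ^ w)"
    using q by (intro mult_left_mono 1) auto
  also have "\<dots> = q ^ w * exp 1 ^ w" by (subst (4) e) (simp add: power_add mult_ac)
  finally show ?thesis by (simp add: power_mult_distrib mult.commute)
qed

text \<open>The family of copies given by all permutations undergoes \<open>m\<close> rounds. The
  failure probability is at most \<open>m\<close> times the cost
  \<open>8 * exp 1 ^ 3 * m / ln n ^ 5\<close> of one round.\<close>

lemma prob_gnp_contains_tree_ge: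
  fixes T :: "'a sgraph"
  assumes T: "is_tree T" and n: "card (verts T) = n" and d: "max_degree T \<le> d"
    and n2: "2 \<le> n" and L: "2 \<le> L" "ln (real n) \<le> real L" and m: "real L * ln (real n) < real m"
    and small: "8 * exp 1 ^ 3 * real m \<le> ln (real n) ^ 5"
  shows "1 - real m * (8 * exp 1 ^ 3 * real m / ln (real n) ^ 5) \<le>
    measure_pmf.prob (gnp n (real d * ln (real n) ^ 5 / real n)) {G. contains_copy G T}"
proof (rule rooted_tree_numbering[OF T n d])
  fix h r par and dep :: "nat \<Rightarrow> nat"
  assume h: "bij_betw h {..<n} (verts T)" and r: "r < n"
    and par: "\<And>x. x \<in> {..<n} - {r} \<Longrightarrow> par x \<in> {..<n} \<and> dep (par x) < dep x"
    and children: "\<And>y. y \<in> {..<n} \<Longrightarrow> card {x \<in> {..<n} - {r}. par x = y} \<le> d"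
    and edge: "\<And>e. e \<in> edges T \<Longrightarrow> \<exists>x\<in>{..<n} - {r}. e = {h x, h (par x)}"
  let ?V = "{..<n}" and ?l = "ln (real n) ^ 5" and ?e = "exp 1 :: real"
  define R where "R \<pi> = (\<lambda>x. {\<pi> x, \<pi> (par x)}) ` (?V - {r})" for \<pi> :: "nat \<Rightarrow> nat"
  define c where "c = real d * ?l / real n"
  define \<delta> where "\<delta> = 8 * ?e ^ 3 * real m / ?l"
  have lpos: "0 < ?l" using n2 by simp
  have mpos: "0 < real m"
  proof -
    have "0 \<le> real L * ln (real n)" using n2 by simp
    thus ?thesis using m by linarith
  qed
  have d0: "0 \<le> \<delta>" "\<delta> \<le> 1" using small lpos by (auto simp: \<delta>_def)
  have copy: "contains_copy \<lparr>verts = ?V, edges = W\<rparr> T" if \<pi>: "\<pi> permutes ?V" "R \<pi> \<subseteq> W" for \<pi> W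
    unfolding contains_copy_def
  proof (intro exI conjI ballI)
    let ?f = "\<pi> \<circ> inv_into ?V h"
    have "bij_betw ?f (verts T) ?V"
      using bij_betw_inv_into[OF h] permutes_imp_bij[OF \<pi>(1)] by (rule bij_betw_trans)
    thus "inj_on ?f (verts T)" "?f ` verts T \<subseteq> verts \<lparr>verts = ?V, edges = W\<rparr>"
      by (auto simp: bij_betw_def)
    fix e assume "e \<in> edges T"
    then obtain x where x: "x \<in> ?V - {r}" "e = {h x, h (par x)}" using edge by blast
    have "?f ` e = {\<pi> x, \<pi> (par x)}"
      using x par[OF x(1)] h by (simp add: bij_betw_inv_into_left)
    thus "?f ` e \<in> edges \<lparr>verts = ?V, edges = W\<rparr>" using \<pi>(2) x(1) by (auto simp: R_def)
  qed
  have RX: "R \<pi> \<subseteq> pairs ?V" if "\<pi> permutes ?V" for \<pi>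
  proof
    fix e assume "e \<in> R \<pi>"
    then obtain x where x: "x \<in> ?V - {r}" "e = {\<pi> x, \<pi> (par x)}" by (auto simp: R_def)
    have "x \<noteq> par x" using par[OF x(1)] by auto
    hence "\<pi> x \<noteq> \<pi> (par x)" using permutes_inj[OF that] by (auto dest: injD)
    thus "e \<in> pairs ?V"
      using x par[OF x(1)] permutes_in_image[OF that] by (auto simp: pairs_def)
  qed
  show ?thesis
  proof (cases "1 \<le> c")
    case True
    have "contains_copy \<lparr>verts = ?V, edges = pairs ?V\<rparr> T"
      using copy[OF permutes_id] RX[OF permutes_id] by blast
    hence "measure_pmf.prob (gnp n c) {G. contains_copy G T} = 1"
      using gnp_complete[OF True, of n] by simp
    moreover have "0 \<le> real m * \<delta>" using d0 by simp
    ultimately show ?thesis unfolding c_def \<delta>_def by linarith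
  next
    case False
    \<comment> \<open>\<open>q\<close> is the spread constant of the random copies; \<open>p\<close>
      shares the edge probability equally among the \<open>m\<close> rounds.\<close>
    define q where "q = 2 * ?e ^ 2 * real d / real n"
    define p where "p = c / real m"
    have dpos: "1 \<le> d"
    proof -
      \<comment> \<open>Some vertex is not the root, and its parent has at least one child.\<close>
      have "(if r = 0 then 1 else 0) \<in> ?V - {r}" using n2 by auto
      then obtain x where x: "x \<in> ?V - {r}" by blast
      hence "card {x' \<in> ?V - {r}. par x' = par x} > 0" by (subst card_gt_0_iff) auto
      thus ?thesis using children[of "par x"] par[OF x] by linarith
    qed
    have e1: "1 \<le> ?e" by simp
    have c: "0 < c" "c < 1" using False dpos lpos n2 by (auto simp: c_def)
    have m1: "1 \<le> real m" using mpos by simp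
    have p: "0 < p" "p \<le> 1" using c m1 by (auto simp: p_def divide_simps)
    have q0: "0 < q" using dpos n2 by (simp add: q_def)
    have "2 * ?e ^ 2 \<le> 8 * ?e ^ 3 * real m"
    proof -
      have "2 * ?e ^ 2 * 1 \<le> 8 * ?e ^ 3 * real m"
        using m1 e1 by (intro mult_mono power_increasing) auto
      thus ?thesis by simp
    qed
    hence "q \<le> c" unfolding q_def c_def using small dpos n2
      by (intro divide_right_mono) (auto simp: mult.commute intro!: mult_left_mono)
    hence q: "q \<le> 1" using c by simp
    have qn: "1 / real n \<le> q"
    proof -
      have "1 \<le> ?e ^ 2" by (rule one_le_power[OF e1])
      hence "1 * 1 \<le> (2 * ?e ^ 2) * real d"
        using dpos by (intro mult_mono) linarith+
      thus ?thesis unfolding q_def by (intro divide_right_mono) auto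
    qed
    \<comment> \<open>Both \<open>d\<close> and \<open>n\<close> cancel here, except for the
      logarithm in \<open>?l\<close>.\<close>
    have \<delta>: "4 / p * (?e * q) = \<delta>"
      unfolding p_def q_def c_def \<delta>_def using dpos n2 lpos mpos
      by (simp add: field_simps power2_eq_square power3_eq_cube)
    have round: "(4 / p) ^ w * q ^ Suc (w - 1 - w div L) \<le> \<delta>" if "0 < w" for w
    proof -
      have "(4 / p) ^ w * q ^ Suc (w - 1 - w div L) \<le> (4 / p) ^ w * (?e * q) ^ w"
        using p that L qn n2 by (intro mult_left_mono shrink_weight[where n = n]) auto
      also have "\<dots> = \<delta> ^ w" by (simp only: power_mult_distrib[symmetric] \<delta>)
      also have "\<dots> \<le> \<delta> ^ 1" using that d0 by (intro power_decreasing) auto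
      finally show ?thesis by simp
    qed
    let ?I = "{\<pi>. \<pi> permutes ?V}" and ?X = "pairs ?V"
    let ?U = "{W. \<exists>\<pi>\<in>?I. R \<pi> \<subseteq> W}"
    let ?p' = "1 - (1 - p) ^ m"
    have X: "finite ?X" by (simp add: finite_pairs)
    have "measure_pmf.prob (random_subset ?X ?p') {W. \<not> (\<exists>\<pi>\<in>?I. R \<pi> \<subseteq> W)}
        \<le> 1 - real (card ?I) / fact n + real m * \<delta>"
    proof (rule prob_contains_no_member_le[where step = "\<lambda>w. w - 1 - w div L" and w = n and q = q])
      show "real (card {\<pi> \<in> ?I. S \<subseteq> R \<pi>}) \<le> q ^ card S * fact n" for S
        using random_tree_copy_spread[of ?V r par dep d S] r par children
        by (simp add: R_def q_def)
      show "card (R \<pi>) \<le> n" if "\<pi> \<in> ?I" for \<pi>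
        unfolding R_def using card_image_le[of "?V - {r}" "\<lambda>x. {\<pi> x, \<pi> (par x)}"] r by simp
      show "((\<lambda>w. w - 1 - w div L) ^^ m) n = 0"
        using n2 L m by (intro shrink_iterate_eq_0) auto
    qed (use X p q0 q d0 round RX finite_permutations[of ?V] in auto)
    \<comment> \<open>\<open>M\<close> is \<open>n!\<close>, the size of the whole family, so the
      first two terms cancel.\<close>
    also have "\<dots> = real m * \<delta>" using card_permutations[of ?V n] by simp
    finally have "measure_pmf.prob (random_subset ?X ?p') (- ?U) \<le> real m * \<delta>"
      by (simp add: Collect_neg_eq[symmetric])
    hence "1 - real m * \<delta> \<le> measure_pmf.prob (random_subset ?X ?p') ?U"
      using measure_pmf.prob_compl[of ?U "random_subset ?X ?p'"] by (simp add: Compl_eq_Diff_UNIV)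
    also have "\<dots> \<le> measure_pmf.prob (random_subset ?X c) ?U"
    proof (rule prob_random_subset_mono[OF X])
      show "0 \<le> ?p'" using p by (simp add: power_le_one)
      \<comment> \<open>The union of \<open>m\<close> rounds of density \<open>p\<close> has density
        at most \<open>m * p = c\<close>.\<close>
      have "1 - real m * p \<le> (1 - p) ^ m"
        using Bernoulli_inequality[of "- p" m] p by simp
      thus "?p' \<le> c" using mpos by (simp add: p_def)
    qed (use c in auto)
    also have "\<dots> \<le> measure_pmf.prob (random_subset ?X c) {W. contains_copy \<lparr>verts = ?V, edges = W\<rparr> T}"
      using copy by (intro measure_pmf.finite_measure_mono) auto
    also have "\<dots> = measure_pmf.prob (gnp n c) {G. contains_copy G T}"
      using c by (simp add: gnp_eq_random_subset vimage_def)
    finally show ?thesis by (simp add: c_def \<delta>_def)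
  qed
qed

text \<open>With \<open>L\<close> about \<open>ln n\<close> and \<open>m\<close> about
  \<open>ln n ^ 2\<close>, the failure bound has order \<open>m ^ 2 / ln n ^ 5\<close>, that is
  \<open>1 / ln n\<close>.\<close>

theorem theorem1p1:
  fixes T :: "nat \<Rightarrow> 'a sgraph" and \<Delta> :: "nat \<Rightarrow> nat"
  assumes "\<And>n. n \<ge> 1 \<Longrightarrow> is_tree (T n)"
    and "\<And>n. n \<ge> 1 \<Longrightarrow> card (verts (T n)) = n"
    and "\<And>n. n \<ge> 1 \<Longrightarrow> max_degree (T n) \<le> \<Delta> n"
  shows "(\<lambda>n. measure_pmf.prob (gnp n (real (\<Delta> n) * ln (real n) ^ 5 / real n))
                {G. contains_copy G (T n)}) \<longlonglongrightarrow> 1"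
proof (rule tendsto_sandwich)
  let ?P = "\<lambda>n. measure_pmf.prob (gnp n (real (\<Delta> n) * ln (real n) ^ 5 / real n)) {G. contains_copy G (T n)}"
  let ?e = "exp 1 :: real"
  show "(\<lambda>n. 1 - 32 * ?e ^ 3 / ln (real n)) \<longlonglongrightarrow> 1" by real_asymp
  show "\<forall>\<^sub>F n in sequentially. ?P n \<le> 1" by simp
  \<comment> \<open>The threshold gives \<open>small\<close>: as \<open>m \<le> 2 * l ^ 2\<close>,
    it suffices that \<open>16 * exp 1 ^ 3 \<le> l ^ 3\<close>. It also forces
    \<open>16 \<le> l\<close>, from which that bound on \<open>m\<close> follows.\<close>
  have "\<forall>\<^sub>F n in sequentially. ln (real n) \<ge> 16 * ?e ^ 3 \<and> n \<ge> 2"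
    by (intro eventually_conj eventually_ge_at_top) real_asymp
  thus "\<forall>\<^sub>F n in sequentially. 1 - 32 * ?e ^ 3 / ln (real n) \<le> ?P n"
  proof eventually_elim
    case (elim n)
    define l where "l = ln (real n)"
    define L where "L = nat \<lceil>l\<rceil>"
    \<comment> \<open>Floor plus 1, since the number of rounds must strictly exceed
      \<open>L * l\<close>.\<close>
    define m where "m = nat \<lfloor>real L * l\<rfloor> + 1"
    have e1: "1 \<le> ?e ^ 3" by (intro one_le_power) simp
    have l: "16 \<le> l" "16 * ?e ^ 3 \<le> l" using elim e1 unfolding l_def by linarith+
    have L: "2 \<le> L" "l \<le> real L" "real L \<le> l + 1" using l unfolding L_def by linarith+
    have Ll: "0 \<le> real L * l" using l by simp
    hence m: "real L * l < real m" "real m \<le> real L * l + 1" unfolding m_def by linarith+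
    have "real L * l \<le> (l + 1) * l" using L l by (intro mult_right_mono) auto
    moreover have "16 * l \<le> l * l" using l by (intro mult_right_mono) auto
    ultimately have m2: "real m \<le> 2 * l ^ 2"
      using m(2) l(1) unfolding power2_eq_square distrib_right by linarith
    have "8 * ?e ^ 3 * real m \<le> 8 * ?e ^ 3 * (2 * l ^ 2)"
      using m2 by (intro mult_left_mono) auto
    also have "\<dots> = (16 * ?e ^ 3) * l ^ 2" by simp
    also have "\<dots> \<le> l ^ 3 * l ^ 2"
    proof (rule mult_right_mono)
      have "l ^ 1 \<le> l ^ 3" using l by (intro power_increasing) auto
      thus "16 * ?e ^ 3 \<le> l ^ 3" using l by simp
    qed simp
    also have "\<dots> = l ^ 5" by (simp add: power_add[symmetric])
    finally have small: "8 * ?e ^ 3 * real m \<le> l ^ 5" .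
    have "real m * (8 * ?e ^ 3 * real m / l ^ 5) = 8 * ?e ^ 3 * (real m * real m) / l ^ 5"
      by simp
    also have "\<dots> \<le> 8 * ?e ^ 3 * ((2 * l ^ 2) * (2 * l ^ 2)) / l ^ 5"
      using m2 l by (intro divide_right_mono mult_left_mono mult_mono) auto
    also have "\<dots> = 32 * ?e ^ 3 / l"
      using l by (simp add: field_simps power_add[symmetric] eval_nat_numeral)
    finally have "1 - 32 * ?e ^ 3 / l \<le> 1 - real m * (8 * ?e ^ 3 * real m / l ^ 5)" by simp
    also have "\<dots> \<le> ?P n"
      unfolding l_def using elim assms L m small
      by (intro prob_gnp_contains_tree_ge[where L = L]) (auto simp: l_def)
    finally show ?case by (simp add: l_def)
  qed
qed simp

end
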